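(* Let $r, k$ be positive integers with $k \leq r$. Let $\mathcal{P}$ be the set of Dyck paths having no ascending run of length in $\{1,\dots,r\}$ and no descending run of length in $\{k+1,\dots,r\}$. Then $\mathcal{P}$ satisfies the grammatical equation $$\mathcal{P} \cup UD\mathcal{P} \cup U^{r+1}D^{k}(D\mathcal{P})^{r+1-k} = \{\epsilon\} \cup U\mathcal{P}D\mathcal{P} \cup U^{r+1}D^{r+1}\mathcal{P} \cup U^{r+1}(D\mathcal{P})^{r+1},$$ where $\epsilon$ is the empty path.
   Context: A Dyck path is a finite (possibly empty) word in the letters $U$ (standing for $+1$) and $D$ (standing for $-1$) whose partial sums are all nonnegative and whose total sum is $0$. An ascending run (up-run) of length $\ell$ is a block of $\ell$ consecutive $U$'s that is neither preceded nor followed by a $U$; a descending run (down-run) of length $\ell$ is a block of $\ell$ consecutive $D$'s that is neither preceded nor followed by a $D$. The set $\{k+1,\dots,r\}$ is empty when $k=r$. A grammatical equation is an equality of sets of words over $\{U,D\}$, combined by concatenation: for languages $L, L'$, $LL'$ is the set of words $ww'$ with $w\in L$, $w'\in L'$; $L^j$ is the $j$-fold concatenation, $L^0=\{\epsilon\}$; $U$ and $D$ denote the one-letter languages. *)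

theory Defs
  imports Main
begin

datatype step = U | D

type_synonym path = "step list"

fun step_val :: "step \<Rightarrow> int" where
  "step_val U = 1"
| "step_val D = - 1"

definition height :: "path \<Rightarrow> int" where
  "height w = sum_list (map step_val w)"

definition dyck_path :: "path \<Rightarrow> bool" where
  "dyck_path w \<longleftrightarrow> (\<forall>n \<le> length w. 0 \<le> height (take n w)) \<and> height w = 0"

definition has_run :: "step \<Rightarrow> nat \<Rightarrow> path \<Rightarrow> bool" where
  "has_run s l w \<longleftrightarrow> 0 < l \<and>
     (\<exists>u v. w = u @ replicate l s @ v \<and> (u = [] \<or> last u \<noteq> s) \<and> (v = [] \<or> hd v \<noteq> s))"

definition conc :: "'a list set \<Rightarrow> 'a list set \<Rightarrow> 'a list set" (infixr "@@" 75) where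
  "A @@ B = {xs @ ys | xs ys. xs \<in> A \<and> ys \<in> B}"

primrec lang_pow :: "'a list set \<Rightarrow> nat \<Rightarrow> 'a list set" where
  "lang_pow L 0 = {[]}"
| "lang_pow L (Suc n) = L @@ lang_pow L n"

definition restricted_dyck_paths :: "nat \<Rightarrow> nat \<Rightarrow> path set" where
  "restricted_dyck_paths r k =
     {w. dyck_path w \<and> (\<forall>l \<in> {1..r}. \<not> has_run U l w) \<and> (\<forall>l \<in> {k+1..r}. \<not> has_run D l w)}"

end

theory Submission imports Defs begin

text \<open>
  In a Dyck path all of whose ascending runs are longer than \<open>r\<close>, the last descending run is at
  least as long as the ascending run before it, hence also longer than \<open>r\<close>. Consequently appending
  letters \<open>D\<close> to a nonempty path of the class never creates a forbidden descending run.
  A nonempty path of the class starting with at least \<open>r + 2\<close> letters \<open>U\<close> therefore decomposes by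
  first return into \<open>U\<P>D\<P>\<close>, and one starting with exactly \<open>r + 1\<close> letters \<open>U\<close>
  decomposes by its descending first passages into \<open>U\<^sup>r\<^sup>+\<^sup>1(D\<P>)\<^sup>r\<^sup>+\<^sup>1\<close>. Conversely, the only words
  of these two products outside the class are those beginning with \<open>UD\<close>, and those whose first
  descending run has a length in \<open>{k+1..r}\<close>; they make up the two correction terms on the left.
\<close>

section \<open>Runs\<close>

lemma has_run_Nil [simp]: "\<not> has_run s l []"
  by (auto simp: has_run_def)

text \<open>A run is a block of equal letters, so it cannot cross a place where the letter changes;
  cut there, it falls wholly into one factor and keeps its boundary conditions.\<close>

lemma has_run_appendD:
  assumes "has_run s l (x @ y)" and junction: "x = [] \<or> y = [] \<or> last x \<noteq> hd y"
  shows "has_run s l x \<or> has_run s l y"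
proof -
  from assms(1) obtain u v where l: "0 < l" and eq: "x @ y = u @ replicate l s @ v"
    and u: "u = [] \<or> last u \<noteq> s" and v: "v = [] \<or> hd v \<noteq> s"
    by (auto simp: has_run_def)
  consider
      (in_y) us where "u = x @ us" "y = us @ replicate l s @ v"
    | (in_x) us where "x = u @ replicate l s @ us" "v = us @ y"
    | (straddle) us us' where "x = u @ us" "replicate l s = us @ us'" "y = us' @ v"
  proof -
    from eq consider us where "x @ us = u" "y = us @ replicate l s @ v"
      | us where "x = u @ us" "us @ y = replicate l s @ v"
      unfolding append_eq_append_conv2 by blast
    then show thesis
    proof cases
      case (2 us)
      from 2(2) consider us' where "us = replicate l s @ us'" "us' @ y = v"
        | us' where "replicate l s = us @ us'" "y = us' @ v"
        unfolding append_eq_append_conv2 by metis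
      then show thesis using 2(1) in_x straddle by cases auto
    qed (use in_y in auto)
  qed
  then show ?thesis
  proof cases
    case in_y
    then have "has_run s l y"
      unfolding has_run_def using l u v
      by (intro conjI exI[of _ us] exI[of _ v]) auto
    then show ?thesis ..
  next
    case in_x
    then have "has_run s l x"
      unfolding has_run_def using l u v
      by (intro conjI exI[of _ u] exI[of _ us]) auto
    then show ?thesis ..
  next
    case straddle
    have "set (us @ us') \<subseteq> {s}" unfolding straddle(2)[symmetric] by auto
    then have us: "set us \<subseteq> {s}" "set us' \<subseteq> {s}" by simp_all
    show ?thesis
    proof (cases "us = [] \<or> us' = []")
      case True
      then show ?thesis
      proof
        assume "us = []"
        with straddle have "has_run s l y"
          unfolding has_run_def using l v
          by (intro conjI exI[of _ "[]"] exI[of _ v]) auto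
        then show ?thesis ..
      next
        assume "us' = []"
        with straddle have "has_run s l x"
          unfolding has_run_def using l u
          by (intro conjI exI[of _ u] exI[of _ "[]"]) auto
        then show ?thesis ..
      qed
    next
      \<comment> \<open>A block with letters on both sides of the cut would give
        \<open>last x = s = hd y\<close>, against \<open>junction\<close>.\<close>
      case False
      then have "last us = s" "hd us' = s"
        using us last_in_set[of us] hd_in_set[of us'] by blast+
      with False straddle junction show ?thesis by auto
    qed
  qed
qed

text \<open>The converse holds because a run that touches the cut stays maximal: the letter across
  the cut differs. This is what lets the run conditions be checked factor by factor.\<close>

lemma has_run_append:
  assumes "x = [] \<or> y = [] \<or> last x \<noteq> hd y"
  shows "has_run s l (x @ y) \<longleftrightarrow> has_run s l x \<or> has_run s l y"
proof
  show "has_run s l x \<or> has_run s l y" if "has_run s l (x @ y)"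
    using has_run_appendD[OF that assms] .
next
  assume "has_run s l x \<or> has_run s l y"
  then show "has_run s l (x @ y)"
  proof
    assume "has_run s l x"
    then obtain u v where x: "0 < l" "x = u @ replicate l s @ v"
      and u: "u = [] \<or> last u \<noteq> s" and v: "v = [] \<or> hd v \<noteq> s"
      by (auto simp: has_run_def)
    then have "x \<noteq> []" "v = [] \<Longrightarrow> last x = s" by auto
    with assms v have "v @ y = [] \<or> hd (v @ y) \<noteq> s" by (cases v) auto
    moreover have "x @ y = u @ replicate l s @ (v @ y)" using x by simp
    ultimately show ?thesis unfolding has_run_def using x(1) u by blast
  next
    assume "has_run s l y"
    then obtain u v where y: "0 < l" "y = u @ replicate l s @ v"
      and u: "u = [] \<or> last u \<noteq> s" and v: "v = [] \<or> hd v \<noteq> s"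
      by (auto simp: has_run_def)
    then have "y \<noteq> []" "u = [] \<Longrightarrow> hd y = s" by (auto simp: hd_append)
    with assms u have "x @ u = [] \<or> last (x @ u) \<noteq> s" by (cases "u = []") auto
    moreover have "x @ y = (x @ u) @ replicate l s @ v" using y by simp
    ultimately show ?thesis unfolding has_run_def using y(1) v by blast
  qed
qed

lemma has_run_replicate: "has_run s l (replicate n t) \<longleftrightarrow> s = t \<and> l = n \<and> 0 < n"
proof
  assume "has_run s l (replicate n t)"
  then obtain u v where l: "0 < l" and eq: "replicate n t = u @ replicate l s @ v"
    and uv: "u = [] \<or> last u \<noteq> s" "v = [] \<or> hd v \<noteq> s"
    by (auto simp: has_run_def)
  from eq have sub: "set (u @ replicate l s @ v) \<subseteq> {t}"
    unfolding eq[symmetric] by auto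
  with l have "s = t" by auto
  moreover from sub uv this have "u = []" "v = []"
    using last_in_set[of u] hd_in_set[of v] unfolding set_append by blast+
  moreover from this eq have "n = l" by (metis append_Nil append_Nil2 length_replicate)
  ultimately show "s = t \<and> l = n \<and> 0 < n" using l by simp
next
  assume "s = t \<and> l = n \<and> 0 < n"
  then show "has_run s l (replicate n t)"
    unfolding has_run_def by (auto intro!: exI[of _ "[]"])
qed

lemma leading_block:
  obtains n y where "w = replicate n s @ y" and "y = [] \<or> hd y \<noteq> s"
proof
  show "w = replicate (length (takeWhile ((=) s) w)) s @ dropWhile ((=) s) w"
  proof -
    have "takeWhile ((=) s) w = replicate (length (takeWhile ((=) s) w)) s"
      by (rule replicate_eqI) (auto dest: set_takeWhileD)
    then show ?thesis by (metis takeWhile_dropWhile_id)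
  qed
  show "dropWhile ((=) s) w = [] \<or> hd (dropWhile ((=) s) w) \<noteq> s"
    by (metis hd_dropWhile)
qed

lemma trailing_block:
  obtains n y where "w = y @ replicate n s" and "y = [] \<or> last y \<noteq> s"
proof -
  obtain n y where "rev w = replicate n s @ y" "y = [] \<or> hd y \<noteq> s"
    by (rule leading_block)
  then have "w = rev y @ replicate n s" "rev y = [] \<or> last (rev y) \<noteq> s"
    by (auto simp: rev_swap last_rev)
  then show thesis by (rule that)
qed

lemma step_neq_iff: "s \<noteq> U \<longleftrightarrow> s = D" "s \<noteq> D \<longleftrightarrow> s = U"
  by (cases s; simp)+

section \<open>Descending to the axis\<close>

text \<open>Paths from height \<open>n\<close> to the axis that never go below it; Dyck paths are
  the case \<open>n = 0\<close>. Allowing any starting height makes the property computable letter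
  by letter and suited to induction.\<close>

fun descends :: "nat \<Rightarrow> path \<Rightarrow> bool" where
  "descends n [] \<longleftrightarrow> n = 0"
| "descends n (U # w) \<longleftrightarrow> descends (Suc n) w"
| "descends 0 (D # w) \<longleftrightarrow> False"
| "descends (Suc n) (D # w) \<longleftrightarrow> descends n w"

lemma height_simps [simp]: "height [] = 0" "height (s # w) = step_val s + height w"
  by (simp_all add: height_def)

text \<open>Absorbs the first letter into the starting height, which is the recursion of
  \<open>descends\<close>. Here \<open>m\<close> is an integer, so that a step below the axis is
  covered too.\<close>

lemma nonneg_prefixes_Cons:
  "(\<forall>i \<le> length (s # w). 0 \<le> m + height (take i (s # w))) \<longleftrightarrow>
    0 \<le> m \<and> (\<forall>i \<le> length w. 0 \<le> (m + step_val s) + height (take i w))"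
  (is "?L \<longleftrightarrow> ?R")
proof
  assume L: ?L
  have "0 \<le> m" using L[rule_format, of 0] by simp
  moreover have "0 \<le> (m + step_val s) + height (take i w)" if "i \<le> length w" for i
    using L[rule_format, of "Suc i"] that by (simp add: add.assoc)
  ultimately show ?R by blast
next
  assume R: ?R
  have "0 \<le> m + height (take i (s # w))" if "i \<le> length (s # w)" for i
    using R that by (cases i) (simp_all add: add.assoc)
  then show ?L by blast
qed

lemma descends_iff:
  "descends n w \<longleftrightarrow>
    (\<forall>i \<le> length w. 0 \<le> int n + height (take i w)) \<and> int n + height w = 0"
proof (induction n w rule: descends.induct)
  case (2 n w)
  have "int (Suc n) = int n + 1" by simp
  with 2 show ?case unfolding nonneg_prefixes_Cons by (simp add: ac_simps)
next
  case (3 w)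
  have "\<not> (\<forall>i \<le> length w. 0 \<le> (int 0 + step_val D) + height (take i w))"
    by (auto intro!: exI[of _ 0])
  then show ?case unfolding nonneg_prefixes_Cons by simp
next
  case (4 n w)
  have "int (Suc n) + step_val D = int n" by simp
  with 4 show ?case unfolding nonneg_prefixes_Cons by (simp add: add.assoc[symmetric])
qed auto

lemma dyck_path_iff: "dyck_path w \<longleftrightarrow> descends 0 w"
  by (simp add: dyck_path_def descends_iff)

text \<open>Started \<open>n\<close> higher, \<open>x\<close> stays at height at least
  \<open>n\<close> and ends exactly there, which is where \<open>y\<close> begins.\<close>

lemma descends_append: "descends m x \<Longrightarrow> descends (m + n) (x @ y) \<longleftrightarrow> descends n y"
  by (induction m x rule: descends.induct) auto

lemma dyck_append: "descends 0 x \<Longrightarrow> descends n (x @ y) \<longleftrightarrow> descends n y"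
  using descends_append[of 0 x n y] by simp

lemma descends_suffix: "descends n (x @ y) \<Longrightarrow> \<exists>h. descends h y"
  by (induction n x rule: descends.induct) auto

lemma descends_replicate_U: "descends n (replicate j U @ y) \<longleftrightarrow> descends (n + j) y"
  by (induction j arbitrary: n) auto

lemma descends_replicate_D: "descends n (replicate i D) \<longleftrightarrow> i = n"
proof (induction i arbitrary: n)
  case (Suc i)
  then show ?case by (cases n) auto
qed auto

lemma dyck_hd: "descends 0 p \<Longrightarrow> p = [] \<or> hd p = U"
  by (cases p; cases "hd p") auto

text \<open>The suffix made of the last ascent \<open>U^j\<close> and the last descent
  \<open>D^n\<close> starts at some height \<open>h\<close> and ends on the axis, so
  \<open>h + j = n\<close> and hence \<open>j \<le> n\<close>.\<close>

lemma dyck_last_descent: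
  assumes "descends 0 p" and "p \<noteq> []"
  obtains q j n where "p = q @ replicate n D" and "q \<noteq> []" and "hd q = U" and "last q = U"
    and "has_run U j q" and "j \<le> n" and "0 < n"
proof -
  obtain n q where p: "p = q @ replicate n D" and q: "q = [] \<or> last q \<noteq> D"
    by (rule trailing_block)
  have hd: "hd p = U" using dyck_hd assms by blast
  have "q \<noteq> []" using assms p by (auto simp: descends_replicate_D)
  with q have last: "last q = U" by (simp add: step_neq_iff)
  obtain j q' where q': "q = q' @ replicate j U" and "q' = [] \<or> last q' \<noteq> U"
    by (rule trailing_block)
  moreover from this \<open>q \<noteq> []\<close> last have "j \<noteq> 0" by (cases j) auto
  ultimately have run: "has_run U j q"
    by (subst q', subst has_run_append) (auto simp: has_run_replicate step_neq_iff)
  from assms(1) p q' obtain h where "descends h (replicate j U @ replicate n D)"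
    using descends_suffix[of 0 q'] by auto
  then have "j \<le> n" by (simp add: descends_replicate_U descends_replicate_D)
  with \<open>j \<noteq> 0\<close> have "0 < n" by simp
  show thesis
    using that[OF p \<open>q \<noteq> []\<close> _ last run \<open>j \<le> n\<close> \<open>0 < n\<close>] hd p \<open>q \<noteq> []\<close> by simp
qed

section \<open>Languages\<close>

lemma concI: "x \<in> A \<Longrightarrow> y \<in> B \<Longrightarrow> x @ y \<in> A @@ B"
  by (auto simp: conc_def)

lemma bex_conc_iff: "(\<exists>w \<in> A @@ B. Q w) \<longleftrightarrow> (\<exists>x \<in> A. \<exists>y \<in> B. Q (x @ y))"
  unfolding conc_def by blast

lemma in_conc_iff: "w \<in> A @@ B \<longleftrightarrow> (\<exists>x \<in> A. \<exists>y \<in> B. w = x @ y)"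
  by (auto simp: conc_def)

lemma in_singleton_conc_iff: "w \<in> {x} @@ B \<longleftrightarrow> (\<exists>y \<in> B. w = x @ y)"
  by (simp add: in_conc_iff)

lemma lang_pow_singleton: "lang_pow {[s]} n = {replicate n s}"
  by (induction n) (auto simp: conc_def)

lemma in_lang_pow_D_Suc_iff:
  "w \<in> lang_pow ({[D]} @@ A) (Suc n) \<longleftrightarrow>
    (\<exists>p \<in> A. \<exists>v \<in> lang_pow ({[D]} @@ A) n. w = D # p @ v)"
proof -
  have D: "x \<in> {[D]} @@ A \<longleftrightarrow> (\<exists>p \<in> A. x = D # p)" for x
    by (simp add: in_singleton_conc_iff)
  show ?thesis
    unfolding lang_pow.simps in_conc_iff[of w] Bex_def D by (metis append_Cons)
qed

lemma lang_pow_D_hd: "v \<in> lang_pow ({[D]} @@ A) n \<Longrightarrow> v = [] \<or> hd v = D"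
  by (cases n) (auto simp: in_conc_iff)

text \<open>Membership in \<open>B\<close> is asked only of factors in their context, preceded by
  \<open>D\<close> and followed by \<open>D\<close> or the end. The context matters because
  admissibility of a factor is inherited from the whole word.\<close>

lemma lang_pow_D_mono:
  assumes "v \<in> lang_pow ({[D]} @@ A) n"
    and "\<And>x p y. \<lbrakk>v = x @ D # p @ y; p \<in> A; y = [] \<or> hd y = D\<rbrakk> \<Longrightarrow> p \<in> B"
  shows "v \<in> lang_pow ({[D]} @@ B) n"
  using assms
proof (induction n arbitrary: v)
  case (Suc n)
  then obtain p v' where v: "v = D # p @ v'" "p \<in> A" "v' \<in> lang_pow ({[D]} @@ A) n"
    by (auto simp: in_conc_iff)
  have "p \<in> B" using Suc.prems(2)[of "[]" p v'] v lang_pow_D_hd by auto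
  moreover have "v' \<in> lang_pow ({[D]} @@ B) n"
  proof (rule Suc.IH[OF v(3)])
    fix x p' y
    assume "v' = x @ D # p' @ y" "p' \<in> A" "y = [] \<or> hd y = D"
    then show "p' \<in> B" using Suc.prems(2)[of "D # p @ x" p' y] v by simp
  qed
  ultimately show ?case using v in_lang_pow_D_Suc_iff by blast
qed simp

text \<open>First passage decomposition: cut before each \<open>D\<close> that reaches a height
  below the start for the first time. The pieces between the cuts are Dyck paths.\<close>

lemma descends_decomposition:
  "descends n v \<Longrightarrow>
    v \<in> {p. descends 0 p} @@ lang_pow ({[D]} @@ {p. descends 0 p}) n"
proof (induction n v rule: descends.induct)
  case (2 n w)
  then obtain p0 v0 where "w = p0 @ v0" "descends 0 p0"
    "v0 \<in> lang_pow ({[D]} @@ {p. descends 0 p}) (Suc n)"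
    unfolding in_conc_iff[of w] by auto
  then obtain p1 v where "w = p0 @ D # p1 @ v" and p: "descends 0 p0" "descends 0 p1"
    and v: "v \<in> lang_pow ({[D]} @@ {p. descends 0 p}) n"
    unfolding in_lang_pow_D_Suc_iff by auto
  \<comment> \<open>The first passage of \<open>w\<close> only undoes the initial \<open>U\<close>,
    so it is merged into the leading Dyck factor and one passage fewer remains.\<close>
  then have "U # w = (U # p0 @ D # p1) @ v" by simp
  moreover have "descends 0 (U # p0 @ D # p1)"
    using p by (simp add: dyck_append)
  ultimately show ?case using v unfolding in_conc_iff by blast
next
  case (4 n w)
  then have "D # w \<in> lang_pow ({[D]} @@ {p. descends 0 p}) (Suc n)"
    unfolding in_lang_pow_D_Suc_iff by (auto simp: in_conc_iff)
  then have "[] @ D # w \<in> {p. descends 0 p} @@ lang_pow ({[D]} @@ {p. descends 0 p}) (Suc n)"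
    by (intro concI) simp
  then show ?case by simp
qed (auto simp: in_conc_iff)

lemma lang_pow_D_descends:
  assumes "A \<subseteq> {p. descends 0 p}"
  shows "v \<in> lang_pow ({[D]} @@ A) n \<Longrightarrow> descends n v"
  using assms by (induction n arbitrary: v) (auto simp: in_conc_iff dyck_append subset_iff)

text \<open>The last \<open>D\<close> of the block carries \<open>p\<close>; each earlier one
  carries the empty path.\<close>

lemma lang_pow_D_replicate:
  assumes "[] \<in> A" and "p \<in> A" and "v \<in> lang_pow ({[D]} @@ A) n"
  shows "replicate (Suc i) D @ p @ v \<in> lang_pow ({[D]} @@ A) (Suc i + n)"
proof (induction i)
  case 0
  then show ?case using assms unfolding add_Suc in_lang_pow_D_Suc_iff by auto
next
  case (Suc i)
  have "([D] @ []) @ replicate (Suc i) D @ p @ v \<in>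
      ({[D]} @@ A) @@ lang_pow ({[D]} @@ A) (Suc i + n)"
    using assms(1) Suc by (intro concI) simp_all
  then show ?case by simp
qed

text \<open>Split at the first nonempty factor \<open>p\<close>: \<open>i\<close> empty factors come
  before it, and its own \<open>D\<close> makes \<open>Suc i\<close>. If \<open>p\<close> begins
  with \<open>U\<close>, this is the length of the first descent.\<close>

lemma lang_pow_D_first_descent:
  assumes "v \<in> lang_pow ({[D]} @@ A) n"
  shows "v = replicate n D \<or> (\<exists>i p y. i < n \<and> p \<in> A \<and> p \<noteq> [] \<and>
    y \<in> lang_pow ({[D]} @@ A) (n - Suc i) \<and> v = replicate (Suc i) D @ p @ y)"
  using assms
proof (induction n arbitrary: v)
  case (Suc n)
  then obtain p v' where v: "v = D # p @ v'" "p \<in> A" "v' \<in> lang_pow ({[D]} @@ A) n"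
    by (auto simp: in_conc_iff)
  show ?case
  proof (cases "p = []")
    case False
    then show ?thesis using v by (intro disjI2 exI[of _ 0] exI[of _ p] exI[of _ v']) simp
  next
    case True
    from Suc.IH[OF v(3)] show ?thesis
    proof (elim disjE exE conjE)
      assume "v' = replicate n D"
      then show ?thesis using v True by simp
    next
      fix i p' y
      assume "i < n" "p' \<in> A" "p' \<noteq> []" "y \<in> lang_pow ({[D]} @@ A) (n - Suc i)"
        "v' = replicate (Suc i) D @ p' @ y"
      then show ?thesis
        using v True by (intro disjI2 exI[of _ "Suc i"] exI[of _ p'] exI[of _ y]) simp
    qed
  qed
qed simp

section \<open>Admissible words\<close>

text \<open>The run conditions without the Dyck condition, so that they also apply to fragments of
  paths. Since runs have positive length, the forbidden intervals become inequalities.\<close>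

definition admissible :: "nat \<Rightarrow> nat \<Rightarrow> path \<Rightarrow> bool" where
  "admissible r k w \<longleftrightarrow>
    (\<forall>l. has_run U l w \<longrightarrow> r < l) \<and> (\<forall>l. has_run D l w \<longrightarrow> l \<le> k \<or> r < l)"

lemma restricted_dyck_paths_iff:
  "w \<in> restricted_dyck_paths r k \<longleftrightarrow> descends 0 w \<and> admissible r k w"
proof -
  have "0 < l" if "has_run s l w" for s l
    using that by (simp add: has_run_def)
  then show ?thesis
    unfolding restricted_dyck_paths_def admissible_def dyck_path_iff
    by (auto simp: Suc_le_eq not_less[symmetric]; meson not_le)
qed

lemma admissible_Nil [simp]: "admissible r k []"
  by (simp add: admissible_def)

lemma admissible_append:
  "x = [] \<or> y = [] \<or> last x \<noteq> hd y \<Longrightarrow>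
    admissible r k (x @ y) \<longleftrightarrow> admissible r k x \<and> admissible r k y"
  by (auto simp: admissible_def has_run_append)

lemma admissible_replicate_U: "admissible r k (replicate n U) \<longleftrightarrow> n = 0 \<or> r < n"
  by (auto simp: admissible_def has_run_replicate)

lemma admissible_replicate_D: "admissible r k (replicate n D) \<longleftrightarrow> n \<le> k \<or> r < n"
  by (auto simp: admissible_def has_run_replicate)

lemma admissible_leading_U:
  "y = [] \<or> hd y = D \<Longrightarrow>
    admissible r k (replicate n U @ y) \<longleftrightarrow> (n = 0 \<or> r < n) \<and> admissible r k y"
  by (subst admissible_append) (auto simp: admissible_replicate_U)

lemma admissible_trailing_D:
  "x = [] \<or> last x = U \<Longrightarrow>
    admissible r k (x @ replicate n D) \<longleftrightarrow> admissible r k x \<and> (n \<le> k \<or> r < n)"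
  by (subst admissible_append) (auto simp: admissible_replicate_D)

text \<open>The last descent is at least as long as some ascent in \<open>q\<close>, hence longer
  than \<open>r\<close> once \<open>q\<close> is admissible. So the part \<open>q\<close> before it
  decides admissibility alone.\<close>

lemma admissible_dyck:
  assumes "descends 0 p" and "p \<noteq> []"
  obtains q n where "p = q @ replicate n D" and "q \<noteq> []" and "hd q = U" and "last q = U"
    and "0 < n" and "admissible r k q \<Longrightarrow> r < n" and "admissible r k p \<longleftrightarrow> admissible r k q"
proof -
  obtain q j n where q: "p = q @ replicate n D" "q \<noteq> []" "hd q = U" "last q = U"
    "has_run U j q" "j \<le> n" "0 < n"
    using assms by (rule dyck_last_descent)
  have n: "r < n" if "admissible r k q"
    using that q(5,6) by (force simp: admissible_def)
  with q have "admissible r k p \<longleftrightarrow> admissible r k q"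
    by (auto simp: admissible_trailing_D)
  with q n show thesis by (intro that)
qed

text \<open>Only the last descent of \<open>p\<close> can merge with its surroundings, and its
  length is irrelevant by \<open>admissible_dyck\<close>. The rest of \<open>p\<close> sits between
  two \<open>D\<close>s and keeps its runs.\<close>

lemma admissible_factor:
  assumes "admissible r k (x @ D # p @ y)" and "descends 0 p" and "y = [] \<or> hd y = D"
  shows "admissible r k p"
proof (cases "p = []")
  case False
  with assms(2) obtain q n where q: "p = q @ replicate n D" "q \<noteq> []" "hd q = U" "last q = U"
    "0 < n" "admissible r k p \<longleftrightarrow> admissible r k q"
    by (rule admissible_dyck)
  have "x @ D # p @ y = (x @ [D]) @ q @ replicate n D @ y" using q by simp
  moreover have "admissible r k ((x @ [D]) @ q @ replicate n D @ y) \<longleftrightarrow>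
      admissible r k (x @ [D]) \<and> admissible r k (q @ replicate n D @ y)"
    by (rule admissible_append) (use q in auto)
  moreover have "admissible r k (q @ replicate n D @ y) \<longleftrightarrow>
      admissible r k q \<and> admissible r k (replicate n D @ y)"
    by (rule admissible_append) (use q in \<open>auto simp: hd_append\<close>)
  ultimately show ?thesis using assms(1) q by simp
qed simp

text \<open>The invariant is that the word read so far ends in a descent longer than
  \<open>r\<close>: a further \<open>D\<close> lengthens it, and a nonempty path of the class ends
  in such a descent again.\<close>

lemma admissible_append_lang_pow_D:
  assumes "v \<in> lang_pow ({[D]} @@ restricted_dyck_paths r k) n"
    and "admissible r k (q @ replicate i D)" and "q \<noteq> []" and "last q = U" and "r < i"
  shows "admissible r k (q @ replicate i D @ v)"
  using assms
proof (induction n arbitrary: v q i)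
  case (Suc n)
  then obtain p v' where v: "v = D # p @ v'" "p \<in> restricted_dyck_paths r k"
    "v' \<in> lang_pow ({[D]} @@ restricted_dyck_paths r k) n"
    by (auto simp: in_conc_iff)
  have longer: "admissible r k (q @ replicate (Suc i) D)"
    using Suc.prems(2,4,5) admissible_trailing_D[of q r k i]
      admissible_trailing_D[of q r k "Suc i"] by auto
  have shift: "replicate (Suc i) D @ z = replicate i D @ D # z" for z
    by (simp add: replicate_app_Cons_same)
  show ?case
  proof (cases "p = []")
    case True
    then show ?thesis
      using Suc.IH[OF v(3) longer] Suc.prems v(1) unfolding append_assoc shift by simp
  next
    case False
    from v(2) have p: "descends 0 p" "admissible r k p"
      by (simp_all add: restricted_dyck_paths_iff)
    obtain q' n' where q': "p = q' @ replicate n' D" "q' \<noteq> []" "hd q' = U" "last q' = U"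
      "r < n'"
      using admissible_dyck[OF p(1) False] p(2) by metis
    let ?x = "q @ replicate (Suc i) D"
    have "admissible r k (?x @ p)"
      using longer p(2) q' by (subst admissible_append) auto
    \<comment> \<open>The induction hypothesis is used with a new prefix, the last descent of
      \<open>p\<close> now being the current one.\<close>
    then have "admissible r k ((?x @ q') @ replicate n' D @ v')"
      by (intro Suc.IH[OF v(3)]) (use q' in auto)
    then show ?thesis using q' v(1) unfolding append_assoc shift by simp
  qed
qed simp

section \<open>The grammatical equation\<close>

lemma restricted_dyck_cases:
  assumes "w \<in> restricted_dyck_paths r k" and "w \<noteq> []"
  obtains (first_return) a b where "w = U # a @ D # b"
      "a \<in> restricted_dyck_paths r k" "b \<in> restricted_dyck_paths r k"
  | (minimal_ascent) v where "w = replicate (Suc r) U @ v"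
      "v \<in> lang_pow ({[D]} @@ restricted_dyck_paths r k) (Suc r)"
proof -
  let ?Dyck = "{p. descends 0 p}"
  from assms have w: "descends 0 w" "admissible r k w"
    by (simp_all add: restricted_dyck_paths_iff)
  then obtain w' where w': "w = U # w'" using dyck_hd[of w] assms(2) by (cases w) auto
  with w(1) have "descends (Suc 0) w'" by simp
  from descends_decomposition[OF this]
  obtain a b where ab: "w = U # a @ D # b" and a: "descends 0 a" and b: "descends 0 b"
    by (auto simp: w' in_conc_iff)
  have "admissible r k b"
    using admissible_factor[of r k "U # a" b "[]"] w(2) ab b by simp
  with b have b_in: "b \<in> restricted_dyck_paths r k" by (simp add: restricted_dyck_paths_iff)
  show thesis
  proof (cases "a = []")
    case True
    then show ?thesis using first_return[OF ab _ b_in] by (simp add: restricted_dyck_paths_iff)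
  next
    case False
    with a obtain q n where q: "a = q @ replicate n D" "q \<noteq> []" "hd q = U" "last q = U"
      and adm_a: "admissible r k a \<longleftrightarrow> admissible r k q"
      by (rule admissible_dyck)
    obtain i z where z: "q = replicate i U @ z" "z = [] \<or> hd z \<noteq> U"
      by (rule leading_block)
    then have z': "z = [] \<or> hd z = D" by (simp add: step_neq_iff)
    \<comment> \<open>Cutting before the last descent of \<open>a\<close> avoids the closing
      \<open>D\<close>, which lengthens that descent in \<open>w\<close>.\<close>
    have "w = (U # q) @ replicate n D @ D # b" using ab q by simp
    then have "admissible r k (U # q)"
      using w(2) q admissible_append[of "U # q" "replicate n D @ D # b" r k]
      by (simp add: hd_append)
    then have "admissible r k (replicate (Suc i) U @ z)" using z by simp
    then have i: "r < Suc i" "admissible r k z"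
      by (simp_all only: admissible_leading_U[OF z']) auto
    show ?thesis
    proof (cases "r < i")
      case True
      with i have "admissible r k q" using z z' by (simp add: admissible_leading_U)
      with a adm_a have "a \<in> restricted_dyck_paths r k" by (simp add: restricted_dyck_paths_iff)
      then show ?thesis using first_return ab b_in by blast
    next
      case False
      with i have "i = r" by simp
      \<comment> \<open>In this case the first ascent of \<open>w\<close> has exactly
        \<open>r + 1\<close> letters, and what follows it starts with \<open>D\<close> whether or
        not \<open>z\<close> is empty.\<close>
      define v where "v = tl (z @ replicate n D @ D # b)"
      have "hd (z @ replicate n D @ D # b) = D" using z' by (auto simp: hd_append)
      then have Dv: "z @ replicate n D @ D # b = D # v"
        unfolding v_def by (metis append_is_Nil_conv list.collapse list.distinct(1))
      have wv: "w = replicate (Suc r) U @ D # v"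
        using ab q z \<open>i = r\<close> Dv by simp
      with w(1) have "descends r v" by (simp only: descends_replicate_U) simp
      \<comment> \<open>The extra \<open>D\<close> in front turns the leading Dyck factor of
        \<open>v\<close> into one more factor, giving \<open>r + 1\<close> in all.\<close>
      then have "D # v \<in> lang_pow ({[D]} @@ ?Dyck) (Suc r)"
        using descends_decomposition[of r v]
        unfolding in_lang_pow_D_Suc_iff in_conc_iff[of v] by auto
      then have "D # v \<in> lang_pow ({[D]} @@ restricted_dyck_paths r k) (Suc r)"
      proof (rule lang_pow_D_mono)
        fix x p y
        assume "D # v = x @ D # p @ y" "p \<in> ?Dyck" "y = [] \<or> hd y = D"
        then show "p \<in> restricted_dyck_paths r k"
          using admissible_factor[of r k "replicate (Suc r) U @ x" p y] w(2) wv
          by (simp add: restricted_dyck_paths_iff)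
      qed
      with wv show ?thesis by (rule minimal_ascent)
    qed
  qed
qed

text \<open>The new \<open>U\<close> lengthens the first ascent of \<open>a\<close> and the new
  \<open>D\<close> its last descent. Both already exceed \<open>r\<close>, so nothing forbidden
  arises.\<close>

lemma restricted_dyck_first_return:
  assumes "a \<in> restricted_dyck_paths r k" and "a \<noteq> []" and "b \<in> restricted_dyck_paths r k"
  shows "U # a @ D # b \<in> restricted_dyck_paths r k"
proof -
  from assms have a: "descends 0 a" "admissible r k a" and b: "descends 0 b" "admissible r k b"
    by (simp_all add: restricted_dyck_paths_iff)
  obtain q n where q: "a = q @ replicate n D" "q \<noteq> []" "hd q = U" "last q = U"
    "r < n" "admissible r k q"
    using admissible_dyck[OF a(1) assms(2)] a(2) by metis
  obtain i z where z: "q = replicate i U @ z" "z = [] \<or> hd z \<noteq> U"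
    by (rule leading_block)
  then have z': "z = [] \<or> hd z = D" by (simp add: step_neq_iff)
  have "i \<noteq> 0" using z q by (cases i) auto
  with q z z' have "r < i" "admissible r k z" by (simp_all add: admissible_leading_U)
  then have "admissible r k (replicate (Suc i) U @ z)"
    by (simp only: admissible_leading_U[OF z']) auto
  then have "admissible r k (U # q)" using z by simp
  then have "admissible r k ((U # q) @ replicate (Suc n) D)"
    using q by (subst admissible_trailing_D) auto
  then have "admissible r k (((U # q) @ replicate (Suc n) D) @ b)"
    using b dyck_hd[OF b(1)] by (subst admissible_append) auto
  moreover have "((U # q) @ replicate (Suc n) D) @ b = U # a @ D # b"
    using q by (simp add: replicate_app_Cons_same[symmetric])
  moreover have "descends 0 (U # a @ D # b)" using a b by (simp add: dyck_append)
  ultimately show ?thesis unfolding restricted_dyck_paths_iff by metis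
qed

text \<open>Only the first descent can be forbidden: after the first nonempty factor, every descent
  is harmless by \<open>admissible_append_lang_pow_D\<close>.\<close>

lemma restricted_dyck_minimal_ascent:
  assumes v: "v \<in> lang_pow ({[D]} @@ restricted_dyck_paths r k) (Suc r)" and "k \<le> r"
  shows "replicate (Suc r) U @ v \<in> restricted_dyck_paths r k \<or>
    (\<exists>y \<in> lang_pow ({[D]} @@ restricted_dyck_paths r k) (Suc r - k). v = replicate k D @ y)"
proof -
  let ?P = "restricted_dyck_paths r k"
  have Nil: "[] \<in> ?P" by (simp add: restricted_dyck_paths_iff)
  have "?P \<subseteq> {p. descends 0 p}" by (auto simp: restricted_dyck_paths_iff)
  then have "descends (Suc r) v" using v by (rule lang_pow_D_descends)
  then have dyck: "descends 0 (replicate (Suc r) U @ v)"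
    by (simp only: descends_replicate_U) simp
  have adm: "admissible r k (replicate (Suc r) U @ v) \<longleftrightarrow> admissible r k v"
    using lang_pow_D_hd[OF v] by (subst admissible_leading_U) auto
  from lang_pow_D_first_descent[OF v] show ?thesis
  proof (elim disjE exE conjE)
    assume "v = replicate (Suc r) D"
    then have "admissible r k v" by (simp only: admissible_replicate_D) simp
    with dyck adm show ?thesis by (simp add: restricted_dyck_paths_iff)
  next
    fix i p y
    assume i: "i < Suc r" and p: "p \<in> ?P" "p \<noteq> []" and y: "y \<in> lang_pow ({[D]} @@ ?P) (Suc r - Suc i)"
      and v_eq: "v = replicate (Suc i) D @ p @ y"
    from p have p': "descends 0 p" "admissible r k p" by (simp_all add: restricted_dyck_paths_iff)
    show ?thesis
    proof (cases "Suc i \<le> k \<or> r < Suc i")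
      case True
      obtain q n where q: "p = q @ replicate n D" "q \<noteq> []" "hd q = U" "last q = U" "r < n"
        using admissible_dyck[OF p'(1) p(2)] p'(2) by metis
      with p' y have "admissible r k (p @ y)"
        using admissible_append_lang_pow_D[of y r k "Suc r - Suc i" q n] by simp
      with True q have "admissible r k v"
        unfolding v_eq by (subst admissible_append) (simp_all only: admissible_replicate_D, auto)
      with dyck adm show ?thesis by (simp add: restricted_dyck_paths_iff)
    next
      case False
      \<comment> \<open>The first descent is too long by \<open>Suc d\<close>. Its first
        \<open>k\<close> letters are split off; the other \<open>Suc d\<close> begin factors, which
        with those of \<open>y\<close> number \<open>r + 1 - k\<close>.\<close>
      then obtain d where d: "Suc i = k + Suc d" "Suc d + (Suc r - Suc i) = Suc r - k"
        using that[of "i - k"] i by auto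
      have "replicate (Suc d) D @ p @ y \<in> lang_pow ({[D]} @@ ?P) (Suc r - k)"
        using lang_pow_D_replicate[OF Nil p(1) y, of d] unfolding d(2) .
      moreover have "v = replicate k D @ replicate (Suc d) D @ p @ y"
        unfolding v_eq d(1) replicate_add by simp
      ultimately show ?thesis by blast
    qed
  qed
qed

theorem proposition13:
  fixes r k :: nat and P :: "path set"
  assumes "0 < r" and "0 < k" and "k \<le> r"
  defines "P \<equiv> restricted_dyck_paths r k"
  shows "P \<union> {[U]} @@ {[D]} @@ P
           \<union> lang_pow {[U]} (r + 1) @@ lang_pow {[D]} k @@ lang_pow ({[D]} @@ P) (r + 1 - k)
       = {[]} \<union> {[U]} @@ P @@ {[D]} @@ P
           \<union> lang_pow {[U]} (r + 1) @@ lang_pow {[D]} (r + 1) @@ P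
           \<union> lang_pow {[U]} (r + 1) @@ lang_pow ({[D]} @@ P) (r + 1)"
    (is "P \<union> ?UDP \<union> ?short = {[]} \<union> ?UPDP \<union> ?peak \<union> ?min")
proof -
  have Nil: "[] \<in> P" by (simp add: P_def restricted_dyck_paths_iff)
  have UPDP: "w \<in> ?UPDP \<longleftrightarrow> (\<exists>a \<in> P. \<exists>b \<in> P. w = U # a @ D # b)" for w
    by (simp add: in_singleton_conc_iff bex_conc_iff)
  have UDP: "w \<in> ?UDP \<longleftrightarrow> (\<exists>b \<in> P. w = U # D # b)" for w
    by (auto simp: in_conc_iff)
  have min: "w \<in> ?min \<longleftrightarrow>
      (\<exists>v \<in> lang_pow ({[D]} @@ P) (Suc r). w = replicate (Suc r) U @ v)" for w
    unfolding lang_pow_singleton in_singleton_conc_iff by simp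
  have short: "w \<in> ?short \<longleftrightarrow>
      (\<exists>y \<in> lang_pow ({[D]} @@ P) (Suc r - k). w = replicate (Suc r) U @ replicate k D @ y)" for w
    unfolding lang_pow_singleton in_singleton_conc_iff bex_conc_iff by simp
  \<comment> \<open>Each nontrivial term of either side is placed inside the other side: three
    inclusions from left to right, then three back.\<close>
  have "P \<subseteq> {[]} \<union> ?UPDP \<union> ?min"
  proof
    fix w assume w: "w \<in> P"
    show "w \<in> {[]} \<union> ?UPDP \<union> ?min"
    proof (cases "w = []")
      case False
      with w[unfolded P_def] show ?thesis
      proof (cases rule: restricted_dyck_cases)
        case (first_return a b)
        then have "w \<in> ?UPDP" unfolding UPDP P_def[symmetric] by blast
        then show ?thesis by blast
      next
        case (minimal_ascent v)
        then have "w \<in> ?min" unfolding min P_def[symmetric] by blast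
        then show ?thesis by blast
      qed
    qed simp
  qed
  moreover have "?UDP \<subseteq> ?UPDP"
    using Nil unfolding UPDP UDP subset_iff by (metis append_Nil)
  moreover have "?short \<subseteq> ?min"
  proof
    fix w assume "w \<in> ?short"
    then obtain y where y: "y \<in> lang_pow ({[D]} @@ P) (Suc r - k)"
      and w: "w = replicate (Suc r) U @ replicate k D @ y"
      unfolding short by blast
    \<comment> \<open>The \<open>k\<close> bare letters \<open>D\<close> are read as factors with
      empty path; \<open>lang_pow_D_replicate\<close> wants at least one.\<close>
    obtain k' where k': "k = Suc k'" using \<open>0 < k\<close> gr0_implies_Suc by blast
    have "replicate k D @ [] @ y \<in> lang_pow ({[D]} @@ P) (k + (Suc r - k))"
      using lang_pow_D_replicate[OF Nil Nil y, of k'] unfolding k' .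
    then show "w \<in> ?min" unfolding min w using \<open>k \<le> r\<close> by auto
  qed
  moreover have "?UPDP \<subseteq> P \<union> ?UDP"
  proof
    fix w assume "w \<in> ?UPDP"
    then obtain a b where "a \<in> P" "b \<in> P" "w = U # a @ D # b" unfolding UPDP by blast
    then show "w \<in> P \<union> ?UDP"
      using restricted_dyck_first_return[of a r k b] unfolding P_def[symmetric] Un_iff UDP
      \<comment> \<open>An empty \<open>a\<close> gives the correction term starting with
        \<open>UD\<close>; any other gives a path of the class.\<close>
      by (cases "a = []") auto
  qed
  moreover have "?peak \<subseteq> ?min"
  proof
    fix w assume "w \<in> ?peak"
    then obtain p where p: "p \<in> P" "w = replicate (Suc r) U @ replicate (Suc r) D @ p"
      unfolding lang_pow_singleton in_singleton_conc_iff bex_conc_iff by auto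
    have "replicate (Suc r) D @ p @ [] \<in> lang_pow ({[D]} @@ P) (Suc r + 0)"
      by (rule lang_pow_D_replicate[OF Nil p(1)]) simp
    then show "w \<in> ?min" unfolding min p(2) by auto
  qed
  moreover have "?min \<subseteq> P \<union> ?short"
  proof
    fix w assume "w \<in> ?min"
    then obtain v where v: "v \<in> lang_pow ({[D]} @@ P) (Suc r)" "w = replicate (Suc r) U @ v"
      unfolding min by blast
    from restricted_dyck_minimal_ascent[OF v(1)[unfolded P_def] \<open>k \<le> r\<close>]
    show "w \<in> P \<union> ?short"
      unfolding P_def[symmetric] Un_iff short v(2) by blast
  qed
  ultimately show ?thesis using Nil by blast
qed

end
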